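(* Let $R$ be a commutative ring with identity, $S$ a multiplicative subset of $R$ and $M$ an $R$-module. Let $L$ and $N$ denote arbitrary $R$-modules. Then the following assertions hold. (1) Let $M$ be an $S$-finite $R$-module and $f:M\to N$ a $u$-$S$-epimorphism. Then $N$ is $S$-finite. (2) Let $0\to L\xrightarrow{f}M\xrightarrow{g}N\to 0$ be a $u$-$S$-exact sequence. If $L$ and $N$ are $S$-finite, so is $M$. (3) Let $f:M\to N$ be a $u$-$S$-isomorphism. If one of $M$ and $N$ is $S$-finite, so is the other.
   Context: A multiplicative subset $S$ of $R$ is a subset with $1\in S$ and $s_1s_2\in S$ for all $s_1,s_2\in S$. An $R$-module $M$ is $S$-finite if there exist $s\in S$ and a finitely generated submodule $N\subseteq M$ with $sM\subseteq N$. An $R$-module $T$ is $u$-$S$-torsion if there exists $s\in S$ with $sT=0$. An $R$-homomorphism $f$ is a $u$-$S$-monomorphism (resp., $u$-$S$-epimorphism) if $\mathrm{Ker}(f)$ (resp., $\mathrm{Coker}(f)$) is $u$-$S$-torsion, and a $u$-$S$-isomorphism if it is both. A sequence of $R$-modules $M\xrightarrow{f}N\xrightarrow{g}L$ is $u$-$S$-exact (at $N$) if there is $s\in S$ with $s\,\mathrm{Ker}(g)\subseteq \mathrm{Im}(f)$ and $s\,\mathrm{Im}(f)\subseteq \mathrm{Ker}(g)$. A sequence $0\to A\to B\to C\to 0$ is $u$-$S$-exact if it is $u$-$S$-exact at each of $A,B,C$. *)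

theory Defs
  imports "HOL.Hull" "HOL-Algebra.Module" "HOL-Algebra.AbelCoset"
begin

text \<open>
  Modules are those of \<^theory>\<open>HOL-Algebra.Module\<close>. A multiplicative subset of a ring \<open>R\<close> is
  exactly a \<open>submonoid\<close> of the multiplicative monoid of \<open>R\<close>, so the library predicate is used.
\<close>

definition mod_hom ::
  "('r, 'a) ring_scheme \<Rightarrow> ('r, 'm, 'b) module_scheme \<Rightarrow> ('r, 'n, 'c) module_scheme \<Rightarrow> ('m \<Rightarrow> 'n) set"
  where "mod_hom R M N =
    {f \<in> hom (add_monoid M) (add_monoid N).
      \<forall>r \<in> carrier R. \<forall>x \<in> carrier M. f (r \<odot>\<^bsub>M\<^esub> x) = r \<odot>\<^bsub>N\<^esub> f x}"

text \<open>
  Module records extend ring records, but \<open>module\<close> imposes nothing on the fields \<open>mult\<close> and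
  \<open>one\<close>; they are left undefined below.
\<close>

definition zero_module :: "('r, unit) module"
  where "zero_module =
    \<lparr>carrier = {()}, mult = undefined, one = undefined, zero = (), add = (\<lambda>_ _. ()),
     smult = (\<lambda>_ _. ())\<rparr>"

lemma zero_module_is_module:
  assumes "cring R"
  shows "module R (zero_module :: ('r, unit) module)"
proof (rule moduleI)
  show "abelian_group (zero_module :: ('r, unit) module)"
    by (rule abelian_groupI) (auto simp: zero_module_def)
qed (use assms in \<open>auto simp: zero_module_def\<close>)

text \<open>
  The carrier is the set of additive cosets of \<open>H\<close>. The union in \<open>smult\<close> is over representatives
  of \<open>X\<close>; for a submodule \<open>H\<close> all the cosets in this union coincide.
\<close>

definition quotient_module :: "('r, 'm, 'b) module_scheme \<Rightarrow> 'm set \<Rightarrow> ('r, 'm set) module"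
  where "quotient_module M H =
    \<lparr>carrier = a_rcosets\<^bsub>M\<^esub> H, mult = undefined, one = undefined, zero = H, add = set_add M,
     smult = (\<lambda>r X. \<Union>x \<in> X. H +>\<^bsub>M\<^esub> (r \<odot>\<^bsub>M\<^esub> x))\<rparr>"

lemma quotient_smult:
  assumes "module R M" "submodule H R M" "r \<in> carrier R" "x \<in> carrier M"
  shows "r \<odot>\<^bsub>quotient_module M H\<^esub> (H +>\<^bsub>M\<^esub> x) = H +>\<^bsub>M\<^esub> (r \<odot>\<^bsub>M\<^esub> x)"
proof -
  interpret module R M by fact
  interpret sm: submodule H R M by fact
  interpret H: abelian_subgroup H M
    using sm.subgroup_axioms by (intro abelian_subgroupI3 additive_subgroup.intro M.abelian_group_axioms)
  have eq: "H +>\<^bsub>M\<^esub> (r \<odot>\<^bsub>M\<^esub> y) = H +>\<^bsub>M\<^esub> (r \<odot>\<^bsub>M\<^esub> x)" if y: "y \<in> H +>\<^bsub>M\<^esub> x" for y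
  proof -
    obtain h where h: "h \<in> H" "y = h \<oplus>\<^bsub>M\<^esub> x"
      using y by (auto simp: a_r_coset_def')
    have "r \<odot>\<^bsub>M\<^esub> y = r \<odot>\<^bsub>M\<^esub> h \<oplus>\<^bsub>M\<^esub> r \<odot>\<^bsub>M\<^esub> x"
      using h assms(3,4) H.a_Hcarr by (simp add: smult_r_distr)
    then have "r \<odot>\<^bsub>M\<^esub> y \<in> H +>\<^bsub>M\<^esub> (r \<odot>\<^bsub>M\<^esub> x)"
      using h assms(3) by (auto simp: a_r_coset_def')
    then show ?thesis
      using H.a_repr_independence' assms(3,4) smult_closed by metis
  qed
  have "x \<in> H +>\<^bsub>M\<^esub> x" using assms(4) by (rule H.a_rcos_self)
  then have "(\<Union>y \<in> H +>\<^bsub>M\<^esub> x. H +>\<^bsub>M\<^esub> (r \<odot>\<^bsub>M\<^esub> y)) = H +>\<^bsub>M\<^esub> (r \<odot>\<^bsub>M\<^esub> x)"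
    using eq by blast
  then show ?thesis
    by (simp add: quotient_module_def)
qed

lemma quotient_module_is_module:
  assumes "module R M" "submodule H R M"
  shows "module R (quotient_module M H)"
proof -
  interpret module R M by fact
  interpret sm: submodule H R M by fact
  interpret H: abelian_subgroup H M
    using sm.subgroup_axioms by (intro abelian_subgroupI3 additive_subgroup.intro M.abelian_group_axioms)
  have car: "X \<in> carrier (quotient_module M H) \<longleftrightarrow> (\<exists>x \<in> carrier M. X = H +>\<^bsub>M\<^esub> x)" for X
    by (auto simp: quotient_module_def A_RCOSETS_def')
  have add: "(H +>\<^bsub>M\<^esub> x) \<oplus>\<^bsub>quotient_module M H\<^esub> (H +>\<^bsub>M\<^esub> y) = H +>\<^bsub>M\<^esub> (x \<oplus>\<^bsub>M\<^esub> y)"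
    if "x \<in> carrier M" "y \<in> carrier M" for x y
    using H.a_rcos_sum[OF that] by (simp add: quotient_module_def)
  have zero: "\<zero>\<^bsub>quotient_module M H\<^esub> = H +>\<^bsub>M\<^esub> \<zero>\<^bsub>M\<^esub>"
    using H.a_rcos_const[OF H.zero_closed] by (simp add: quotient_module_def)
  have ag: "abelian_group (quotient_module M H)"
  proof (rule abelian_groupI)
    fix X assume "X \<in> carrier (quotient_module M H)"
    then obtain x where x: "x \<in> carrier M" "X = H +>\<^bsub>M\<^esub> x" by (auto simp: car)
    then show "\<exists>Y\<in>carrier (quotient_module M H). Y \<oplus>\<^bsub>quotient_module M H\<^esub> X = \<zero>\<^bsub>quotient_module M H\<^esub>"
      by (intro bexI[of _ "H +>\<^bsub>M\<^esub> (\<ominus>\<^bsub>M\<^esub> x)"]) (auto simp: add zero car M.l_neg)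
  qed (auto simp: car add zero M.add.m_assoc M.add.m_comm M.add.m_lcomm)
  note qs = quotient_smult[OF assms]
  show ?thesis
  proof (rule moduleI)
    show "cring R" by (rule R.cring_axioms)
    show "abelian_group (quotient_module M H)" by (rule ag)
  qed (auto simp: car qs add smult_r_distr smult_l_distr smult_assoc1)
qed

definition kernel_module ::
  "('r, 'm, 'b) module_scheme \<Rightarrow> ('r, 'n, 'c) module_scheme \<Rightarrow> ('m \<Rightarrow> 'n) \<Rightarrow> ('r, 'm, 'b) module_scheme"
  where "kernel_module M N f = M\<lparr>carrier := a_kernel M N f\<rparr>"

definition cokernel_module ::
  "('r, 'm, 'b) module_scheme \<Rightarrow> ('r, 'n, 'c) module_scheme \<Rightarrow> ('m \<Rightarrow> 'n) \<Rightarrow> ('r, 'n set) module"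
  where "cokernel_module M N f = quotient_module N (f ` carrier M)"

lemma image_submodule:
  assumes "module R M" "module R N" "f \<in> mod_hom R M N"
  shows "submodule (f ` carrier M) R N"
proof -
  interpret M: module R M by fact
  interpret N: module R N by fact
  interpret group_hom "add_monoid M" "add_monoid N" f
    using assms(3) by (intro group_hom.intro group_hom_axioms.intro M.M.a_group N.M.a_group) (simp add: mod_hom_def)
  have closed: "r \<odot>\<^bsub>N\<^esub> y \<in> f ` carrier M" if r: "r \<in> carrier R" and y: "y \<in> f ` carrier M" for r y
  proof -
    obtain x where x: "x \<in> carrier M" "y = f x"
      using y by blast
    then have "r \<odot>\<^bsub>N\<^esub> y = f (r \<odot>\<^bsub>M\<^esub> x)"
      using r assms(3) by (simp add: mod_hom_def)
    then show ?thesis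
      using M.smult_closed[OF r x(1)] by blast
  qed
  have "subgroup (f ` carrier M) (add_monoid N)"
    using img_is_subgroup by simp
  then show ?thesis
    using closed by (intro submodule.intro submodule_axioms.intro)
qed

lemma cokernel_module_is_module:
  assumes "module R M" "module R N" "f \<in> mod_hom R M N"
  shows "module R (cokernel_module M N f)"
  unfolding cokernel_module_def
  by (rule quotient_module_is_module[OF assms(2) image_submodule[OF assms]])

definition fin_gen_submodule ::
  "('r, 'a) ring_scheme \<Rightarrow> ('r, 'm, 'b) module_scheme \<Rightarrow> 'm set \<Rightarrow> bool"
  where "fin_gen_submodule R M N \<longleftrightarrow>
    submodule N R M \<and>
    (\<exists>A. finite A \<and> A \<subseteq> carrier M \<and> N = (\<lambda>H. submodule H R M) hull A)"

definition S_finite ::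
  "('r, 'a) ring_scheme \<Rightarrow> 'r set \<Rightarrow> ('r, 'm, 'b) module_scheme \<Rightarrow> bool"
  where "S_finite R S M \<longleftrightarrow>
    (\<exists>s \<in> S. \<exists>N. fin_gen_submodule R M N \<and> (\<forall>x \<in> carrier M. s \<odot>\<^bsub>M\<^esub> x \<in> N))"

definition u_S_torsion :: "'r set \<Rightarrow> ('r, 'm, 'b) module_scheme \<Rightarrow> bool"
  where "u_S_torsion S T \<longleftrightarrow> (\<exists>s \<in> S. \<forall>x \<in> carrier T. s \<odot>\<^bsub>T\<^esub> x = \<zero>\<^bsub>T\<^esub>)"

definition u_S_mono ::
  "('r, 'a) ring_scheme \<Rightarrow> 'r set \<Rightarrow> ('r, 'm, 'b) module_scheme \<Rightarrow> ('r, 'n, 'c) module_scheme \<Rightarrow>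
    ('m \<Rightarrow> 'n) \<Rightarrow> bool"
  where "u_S_mono R S M N f \<longleftrightarrow> f \<in> mod_hom R M N \<and> u_S_torsion S (kernel_module M N f)"

definition u_S_epi ::
  "('r, 'a) ring_scheme \<Rightarrow> 'r set \<Rightarrow> ('r, 'm, 'b) module_scheme \<Rightarrow> ('r, 'n, 'c) module_scheme \<Rightarrow>
    ('m \<Rightarrow> 'n) \<Rightarrow> bool"
  where "u_S_epi R S M N f \<longleftrightarrow> f \<in> mod_hom R M N \<and> u_S_torsion S (cokernel_module M N f)"

definition u_S_iso ::
  "('r, 'a) ring_scheme \<Rightarrow> 'r set \<Rightarrow> ('r, 'm, 'b) module_scheme \<Rightarrow> ('r, 'n, 'c) module_scheme \<Rightarrow>
    ('m \<Rightarrow> 'n) \<Rightarrow> bool"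
  where "u_S_iso R S M N f \<longleftrightarrow> u_S_mono R S M N f \<and> u_S_epi R S M N f"

definition u_S_exact ::
  "('r, 'a) ring_scheme \<Rightarrow> 'r set \<Rightarrow> ('r, 'm, 'b) module_scheme \<Rightarrow> ('r, 'n, 'c) module_scheme \<Rightarrow>
    ('r, 'l, 'd) module_scheme \<Rightarrow> ('m \<Rightarrow> 'n) \<Rightarrow> ('n \<Rightarrow> 'l) \<Rightarrow> bool"
  where "u_S_exact R S M N L f g \<longleftrightarrow>
    f \<in> mod_hom R M N \<and> g \<in> mod_hom R N L \<and>
    (\<exists>s \<in> S. (\<forall>x \<in> a_kernel N L g. s \<odot>\<^bsub>N\<^esub> x \<in> f ` carrier M) \<and>
             (\<forall>y \<in> f ` carrier M. s \<odot>\<^bsub>N\<^esub> y \<in> a_kernel N L g))"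

text \<open>The witnesses in \<open>S\<close> at the three places may differ.\<close>

definition u_S_short_exact ::
  "('r, 'a) ring_scheme \<Rightarrow> 'r set \<Rightarrow> ('r, 'm, 'b) module_scheme \<Rightarrow> ('r, 'n, 'c) module_scheme \<Rightarrow>
    ('r, 'l, 'd) module_scheme \<Rightarrow> ('m \<Rightarrow> 'n) \<Rightarrow> ('n \<Rightarrow> 'l) \<Rightarrow> bool"
  where "u_S_short_exact R S A B C f g \<longleftrightarrow>
    u_S_exact R S zero_module A B (\<lambda>_. \<zero>\<^bsub>A\<^esub>) f \<and>
    u_S_exact R S A B C f g \<and>
    u_S_exact R S B C zero_module g (\<lambda>_. ())"

end

theory Submission
  imports Defs
begin

text \<open>
  All three assertions are instances of one fact, \<open>S_finite_middle\<close>: in a sequence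
  \<open>L \<rightarrow> M \<rightarrow> N \<rightarrow> 0\<close> that is \<open>u\<close>-\<open>S\<close>-exact at \<open>M\<close> and at \<open>N\<close>, the module \<open>M\<close> is \<open>S\<close>-finite
  as soon as \<open>L\<close> and \<open>N\<close> are. Assertion (2) is this fact. A \<open>u\<close>-\<open>S\<close>-epimorphism \<open>M \<rightarrow> N\<close> makes
  \<open>M \<rightarrow> N \<rightarrow> 0 \<rightarrow> 0\<close> such a sequence, with \<open>N\<close> in the middle, which gives (1).
  A \<open>u\<close>-\<open>S\<close>-isomorphism \<open>M \<rightarrow> N\<close> is in particular a \<open>u\<close>-\<open>S\<close>-epimorphism, and it also makes \<open>0 \<rightarrow> M \<rightarrow> N \<rightarrow> 0\<close> such a sequence;
  this gives the two directions of (3).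

  The fact itself is the classical argument for extensions of finitely generated modules, with
  denominators. Let \<open>A\<close> and \<open>B\<close> generate \<open>L\<close> and \<open>N\<close> up to multiplication by elements of \<open>S\<close>.
  The elements of \<open>B\<close> need not lie in the image of \<open>g : M \<rightarrow> N\<close>, but their multiples by a
  suitable \<open>t \<in> S\<close> do; let the finite set \<open>C\<close> consist of one preimage of each multiple. For \<open>x\<close> in \<open>M\<close>, a multiple of
  \<open>g x\<close> agrees with \<open>g z\<close> for some \<open>z\<close> in the span of \<open>C\<close>, so a multiple of \<open>x\<close> differs from
  \<open>z\<close> by an element of \<open>Ker g\<close>, and a further multiple of the difference lies in the span of
  \<open>f A\<close>. Hence \<open>f A \<union> C\<close> generates \<open>M\<close> up to multiplication by an element of \<open>S\<close>.

  Linear combinations never appear: a span is the least submodule containing its generators, so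
  a linear map carries it into any submodule \<open>H\<close> that contains the images of the generators,
  because the preimage of \<open>H\<close> is a submodule.
\<close>

section \<open>Submodules and homomorphisms\<close>

abbreviation span_of :: "('r, 'a) ring_scheme \<Rightarrow> ('r, 'm, 'b) module_scheme \<Rightarrow> 'm set \<Rightarrow> 'm set"
  where "span_of R M A \<equiv> (\<lambda>H. submodule H R M) hull A"

lemma (in module) submodule_span:
  assumes "A \<subseteq> carrier M"
  shows "submodule (span_of R M A) R M"
proof -
  let ?F = "{H. submodule H R M \<and> A \<subseteq> H}"
  have mem: "carrier M \<in> ?F"
    using assms carrier_is_submodule by simp
  have "submodule (\<Inter>?F) R M"
  proof (rule submoduleI)
    show "\<Inter>?F \<subseteq> carrier M"
      using mem by blast
    have "\<zero>\<^bsub>M\<^esub> \<in> H" if "submodule H R M" for H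
      using subgroup.one_closed[OF submodule.axioms(1)[OF that]] by simp
    then show "\<zero>\<^bsub>M\<^esub> \<in> \<Inter>?F"
      by simp
  qed (auto dest: submoduleE(3-5))
  then show ?thesis
    by (simp add: hull_def)
qed

lemma mod_hom_zero:
  assumes "module R M" "module R N" "f \<in> mod_hom R M N"
  shows "f \<zero>\<^bsub>M\<^esub> = \<zero>\<^bsub>N\<^esub>"
proof -
  interpret M: module R M by fact
  interpret N: module R N by fact
  interpret group_hom "add_monoid M" "add_monoid N" f
    using assms(3)
    by (intro group_hom.intro group_hom_axioms.intro M.M.a_group N.M.a_group) (simp add: mod_hom_def)
  show ?thesis
    using hom_one by simp
qed

lemma mod_hom_uminus:
  assumes "module R M" "module R N" "f \<in> mod_hom R M N" "x \<in> carrier M"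
  shows "f (\<ominus>\<^bsub>M\<^esub> x) = \<ominus>\<^bsub>N\<^esub> f x"
proof -
  interpret M: module R M by fact
  interpret N: module R N by fact
  interpret group_hom "add_monoid M" "add_monoid N" f
    using assms(3)
    by (intro group_hom.intro group_hom_axioms.intro M.M.a_group N.M.a_group) (simp add: mod_hom_def)
  show ?thesis
    using hom_inv[of x] assms(4) by (simp add: a_inv_def)
qed

lemma mod_hom_add:
  assumes "f \<in> mod_hom R M N" "x \<in> carrier M" "y \<in> carrier M"
  shows "f (x \<oplus>\<^bsub>M\<^esub> y) = f x \<oplus>\<^bsub>N\<^esub> f y"
  using assms hom_mult[of f "add_monoid M" "add_monoid N"] by (simp add: mod_hom_def)

lemma mod_hom_smult:
  assumes "f \<in> mod_hom R M N" "r \<in> carrier R" "x \<in> carrier M"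
  shows "f (r \<odot>\<^bsub>M\<^esub> x) = r \<odot>\<^bsub>N\<^esub> f x"
  using assms by (simp add: mod_hom_def)

lemma mod_hom_closed:
  assumes "f \<in> mod_hom R M N" "x \<in> carrier M"
  shows "f x \<in> carrier N"
  using assms hom_in_carrier[of f "add_monoid M" "add_monoid N"] by (simp add: mod_hom_def)

text \<open>Commutativity of \<open>R\<close> is what makes a homothety linear.\<close>

lemma (in module) homothety_mod_hom:
  assumes "s \<in> carrier R"
  shows "(\<lambda>x. s \<odot>\<^bsub>M\<^esub> x) \<in> mod_hom R M M"
proof -
  have "s \<odot>\<^bsub>M\<^esub> (r \<odot>\<^bsub>M\<^esub> x) = r \<odot>\<^bsub>M\<^esub> (s \<odot>\<^bsub>M\<^esub> x)" if "r \<in> carrier R" "x \<in> carrier M" for r x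
    using assms that by (simp add: smult_assoc1[symmetric] R.m_comm)
  then show ?thesis
    using assms by (auto simp: mod_hom_def hom_def smult_r_distr)
qed

lemma submodule_vimage:
  assumes "module R M" "module R N" "f \<in> mod_hom R M N" "submodule H R N"
  shows "submodule {x \<in> carrier M. f x \<in> H} R M"
proof -
  interpret M: module R M by fact
  interpret N: module R N by fact
  have "\<zero>\<^bsub>N\<^esub> \<in> H"
    using subgroup.one_closed[OF submodule.axioms(1)[OF assms(4)]] by simp
  then show ?thesis
    using N.submoduleE[OF assms(4)]
    by (intro M.submoduleI)
      (auto simp: mod_hom_zero[OF assms(1-3)] mod_hom_uminus[OF assms(1-3)]
        mod_hom_add[OF assms(3)] mod_hom_smult[OF assms(3)])
qed

lemma submodule_image:
  assumes "module R M" "module R N" "f \<in> mod_hom R M N" "submodule H R M"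
  shows "submodule (f ` H) R N"
proof -
  interpret M: module R M by fact
  have sub: "H \<subseteq> carrier M"
    by (rule M.submoduleE(1)[OF assms(4)])
  have "f \<in> mod_hom R (M\<lparr>carrier := H\<rparr>) N"
    using assms(3) sub by (simp add: mod_hom_def hom_def Pi_def subset_iff)
  from image_submodule[OF submodule.submodule_is_module[OF assms(4,1)] assms(2) this]
  show ?thesis by simp
qed

text \<open>
  The preimage of \<open>H\<close> is a submodule that contains \<open>A\<close>, hence the span of \<open>A\<close>. This replaces the
  expansion of elements of a span as linear combinations.
\<close>

lemma mod_hom_span:
  assumes "module R M" "module R N" "f \<in> mod_hom R M N" "submodule H R N"
    and "A \<subseteq> carrier M" "f ` A \<subseteq> H" "x \<in> span_of R M A"
  shows "f x \<in> H"
proof -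
  have "span_of R M A \<subseteq> {x \<in> carrier M. f x \<in> H}"
    using assms(5,6) by (intro hull_minimal submodule_vimage[OF assms(1-4)]) auto
  then show ?thesis
    using assms(7) by auto
qed

section \<open>Modules that are finitely generated up to S\<close>

lemma (in module) S_finite_iff:
  "S_finite R S M \<longleftrightarrow>
    (\<exists>s \<in> S. \<exists>A. finite A \<and> A \<subseteq> carrier M \<and> (\<forall>x \<in> carrier M. s \<odot>\<^bsub>M\<^esub> x \<in> span_of R M A))"
  unfolding S_finite_def fin_gen_submodule_def using submodule_span by blast

text \<open>
  The witnesses play the roles of the overview: \<open>s\<close> for exactness at \<open>M\<close>, \<open>t\<close> for exactness at
  \<open>N\<close>, \<open>u\<close> and \<open>v\<close> for the \<open>S\<close>-finiteness of \<open>L\<close> and \<open>N\<close>. The multiplier for \<open>M\<close> is \<open>u s t v\<close>.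
\<close>

lemma S_finite_middle:
  assumes S: "submonoid S R"
    and L: "module R L" and M: "module R M" and N: "module R N"
    and f: "f \<in> mod_hom R L M" and g: "g \<in> mod_hom R M N"
    and s: "s \<in> S" "\<And>x. \<lbrakk>x \<in> carrier M; g x = \<zero>\<^bsub>N\<^esub>\<rbrakk> \<Longrightarrow> s \<odot>\<^bsub>M\<^esub> x \<in> f ` carrier L"
    and t: "t \<in> S" "\<And>y. y \<in> carrier N \<Longrightarrow> t \<odot>\<^bsub>N\<^esub> y \<in> g ` carrier M"
    and "S_finite R S L" "S_finite R S N"
  shows "S_finite R S M"
proof -
  interpret L: module R L by fact
  interpret M: module R M by fact
  interpret N: module R N by fact
  interpret S: submonoid S R by fact
  obtain u A where u: "u \<in> S" and A: "finite A" "A \<subseteq> carrier L"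
    and uA: "\<And>x. x \<in> carrier L \<Longrightarrow> u \<odot>\<^bsub>L\<^esub> x \<in> span_of R L A"
    using \<open>S_finite R S L\<close> unfolding L.S_finite_iff by blast
  obtain v B where v: "v \<in> S" and B: "finite B" "B \<subseteq> carrier N"
    and vB: "\<And>y. y \<in> carrier N \<Longrightarrow> v \<odot>\<^bsub>N\<^esub> y \<in> span_of R N B"
    using \<open>S_finite R S N\<close> unfolding N.S_finite_iff by blast
  have "\<forall>b \<in> B. \<exists>c \<in> carrier M. t \<odot>\<^bsub>N\<^esub> b = g c"
    using t(2) B(2) by blast
  then obtain c where c: "\<And>b. b \<in> B \<Longrightarrow> c b \<in> carrier M \<and> t \<odot>\<^bsub>N\<^esub> b = g (c b)"
    by metis
  define C where "C = c ` B"
  have C: "finite C" "C \<subseteq> carrier M"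
    using B c by (auto simp: C_def)
  define G where "G = f ` A \<union> C"
  have G: "finite G" "G \<subseteq> carrier M"
    using A C mod_hom_closed[OF f] by (auto simp: G_def)
  let ?H = "span_of R M G"
  have H: "submodule ?H R M"
    by (rule M.submodule_span[OF G(2)])
  have GH: "G \<subseteq> ?H"
    by (rule hull_subset)
  have CH: "span_of R M C \<subseteq> ?H"
    by (rule hull_mono) (simp add: G_def)
  have car: "u \<in> carrier R" "s \<in> carrier R" "t \<in> carrier R" "v \<in> carrier R"
    using u s(1) t(1) v by auto
  have "u \<otimes>\<^bsub>R\<^esub> (s \<otimes>\<^bsub>R\<^esub> (t \<otimes>\<^bsub>R\<^esub> v)) \<in> S"
    using u s(1) t(1) v by simp
  moreover have "(u \<otimes>\<^bsub>R\<^esub> (s \<otimes>\<^bsub>R\<^esub> (t \<otimes>\<^bsub>R\<^esub> v))) \<odot>\<^bsub>M\<^esub> x \<in> ?H" if x: "x \<in> carrier M" for x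
  proof -
    define x' where "x' = t \<odot>\<^bsub>M\<^esub> (v \<odot>\<^bsub>M\<^esub> x)"
    have x': "x' \<in> carrier M"
      using x car by (simp add: x'_def)
    \<comment> \<open>The homothety by \<open>t\<close> maps the generators \<open>B\<close> into \<open>g C\<close>, hence their span into the image
      of the span of \<open>C\<close>.\<close>
    have "t \<odot>\<^bsub>N\<^esub> (v \<odot>\<^bsub>N\<^esub> g x) \<in> g ` span_of R M C"
    proof (rule mod_hom_span[OF N N N.homothety_mod_hom[OF car(3)] _ B(2)])
      show "submodule (g ` span_of R M C) R N"
        by (rule submodule_image[OF M N g M.submodule_span[OF C(2)]])
      show "(\<lambda>y. t \<odot>\<^bsub>N\<^esub> y) ` B \<subseteq> g ` span_of R M C"
        using c hull_subset[of C] by (force simp: C_def)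
      show "v \<odot>\<^bsub>N\<^esub> g x \<in> span_of R N B"
        using vB mod_hom_closed[OF g x] by simp
    qed
    moreover have "g x' = t \<odot>\<^bsub>N\<^esub> (v \<odot>\<^bsub>N\<^esub> g x)"
      using x car by (simp add: x'_def mod_hom_smult[OF g])
    ultimately obtain z where z: "z \<in> span_of R M C" "g x' = g z"
      by auto
    have zH: "z \<in> ?H"
      using z(1) CH by blast
    have zM: "z \<in> carrier M"
      using zH M.submoduleE(1)[OF H] by blast
    define w where "w = x' \<oplus>\<^bsub>M\<^esub> \<ominus>\<^bsub>M\<^esub> z"
    have w: "w \<in> carrier M"
      using x' zM by (simp add: w_def)
    have "g w = \<zero>\<^bsub>N\<^esub>"
      using x' zM z(2) mod_hom_closed[OF g zM]
      by (simp add: w_def mod_hom_add[OF g] mod_hom_uminus[OF M N g] N.r_neg)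
    then obtain y where y: "y \<in> carrier L" "s \<odot>\<^bsub>M\<^esub> w = f y"
      using s(2)[OF w] by blast
    have "f (u \<odot>\<^bsub>L\<^esub> y) \<in> ?H"
      using GH by (intro mod_hom_span[OF L M f H A(2) _ uA[OF y(1)]]) (auto simp: G_def)
    then have wH: "u \<odot>\<^bsub>M\<^esub> (s \<odot>\<^bsub>M\<^esub> w) \<in> ?H"
      using y car by (simp add: mod_hom_smult[OF f])
    have "x' = w \<oplus>\<^bsub>M\<^esub> z"
      using x' zM by (simp add: w_def M.add.m_assoc M.l_neg)
    then have "u \<odot>\<^bsub>M\<^esub> (s \<odot>\<^bsub>M\<^esub> x') = u \<odot>\<^bsub>M\<^esub> (s \<odot>\<^bsub>M\<^esub> w) \<oplus>\<^bsub>M\<^esub> u \<odot>\<^bsub>M\<^esub> (s \<odot>\<^bsub>M\<^esub> z)"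
      using w zM car by (simp add: M.smult_r_distr)
    also have "\<dots> \<in> ?H"
      by (intro M.submoduleE(5)[OF H wH] M.submoduleE(4)[OF H car(1)] M.submoduleE(4)[OF H car(2) zH])
    finally show ?thesis
      using x car by (simp add: x'_def M.smult_assoc1)
  qed
  ultimately show ?thesis
    unfolding M.S_finite_iff using G by blast
qed

text \<open>
  A coset of the image is zero in the cokernel exactly if its representatives lie in the image, so
  an \<open>s\<close> that annihilates the cokernel multiplies \<open>N\<close> into the image.
\<close>

lemma u_S_epi_image:
  assumes M: "module R M" and N: "module R N" and S: "submonoid S R" and f: "u_S_epi R S M N f"
  obtains s where "s \<in> S" "\<And>y. y \<in> carrier N \<Longrightarrow> s \<odot>\<^bsub>N\<^esub> y \<in> f ` carrier M"
proof -
  interpret N: module R N by fact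
  interpret S: submonoid S R by fact
  have hom: "f \<in> mod_hom R M N"
    using f by (simp add: u_S_epi_def)
  let ?I = "f ` carrier M"
  have I: "submodule ?I R N"
    by (rule image_submodule[OF M N hom])
  interpret I: abelian_subgroup ?I N
    using submodule.axioms(1)[OF I]
    by (intro abelian_subgroupI3 additive_subgroup.intro N.abelian_group_axioms)
  obtain s where s: "s \<in> S"
    "\<And>X. X \<in> a_rcosets\<^bsub>N\<^esub> ?I \<Longrightarrow> s \<odot>\<^bsub>quotient_module N ?I\<^esub> X = ?I"
    using f by (auto simp: u_S_epi_def u_S_torsion_def cokernel_module_def quotient_module_def)
  have image: "s \<odot>\<^bsub>N\<^esub> y \<in> ?I" if y: "y \<in> carrier N" for y
  proof -
    have sR: "s \<in> carrier R"
      using s(1) by auto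
    have "?I +>\<^bsub>N\<^esub> y \<in> a_rcosets\<^bsub>N\<^esub> ?I"
      using y by (auto simp: A_RCOSETS_def')
    then have "?I +>\<^bsub>N\<^esub> (s \<odot>\<^bsub>N\<^esub> y) = ?I"
      using s(2) quotient_smult[OF N I sR y] by metis
    then show ?thesis
      using I.a_rcos_self[OF N.smult_closed[OF sR y]] by simp
  qed
  show ?thesis
    by (rule that[OF s(1) image])
qed

lemma S_finite_zero_module:
  assumes "cring R" "submonoid S R"
  shows "S_finite R S (zero_module :: ('r, unit) module)"
proof -
  interpret Z: module R "zero_module :: ('r, unit) module"
    by (rule zero_module_is_module[OF assms(1)])
  have "span_of R (zero_module :: ('r, unit) module) {()} = UNIV"
    using hull_subset[of "{()}"] by auto
  then show ?thesis
    unfolding Z.S_finite_iff using submonoid.one_closed[OF assms(2)]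
    by (intro bexI[of _ "\<one>\<^bsub>R\<^esub>"] exI[of _ "{()}"]) (simp_all add: zero_module_def)
qed

theorem proposition2p9:
  fixes R :: "('r, 'a) ring_scheme"
    and S :: "'r set"
    and L :: "('r, 'l, 'b) module_scheme"
    and M :: "('r, 'm, 'c) module_scheme"
    and N :: "('r, 'n, 'd) module_scheme"
  assumes "cring R"
    and "submonoid S R"
    and "module R L"
    and "module R M"
    and "module R N"
  shows "(\<forall>f. S_finite R S M \<longrightarrow> u_S_epi R S M N f \<longrightarrow> S_finite R S N) \<and>
    (\<forall>f g. u_S_short_exact R S L M N f g \<longrightarrow> S_finite R S L \<longrightarrow> S_finite R S N \<longrightarrow> S_finite R S M) \<and>
    (\<forall>f. u_S_iso R S M N f \<longrightarrow> (S_finite R S M \<longleftrightarrow> S_finite R S N))"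
proof -
  interpret M: module R M by fact
  interpret N: module R N by fact
  interpret S: submonoid S R by fact
  let ?Z = "zero_module :: ('r, unit) module"
  note Z = zero_module_is_module[OF \<open>cring R\<close>] S_finite_zero_module[OF \<open>cring R\<close> \<open>submonoid S R\<close>]
  have one: "S_finite R S N" if M: "S_finite R S M" and f: "u_S_epi R S M N f" for f
  proof -
    obtain s where s: "s \<in> S" "\<And>y. y \<in> carrier N \<Longrightarrow> s \<odot>\<^bsub>N\<^esub> y \<in> f ` carrier M"
      using u_S_epi_image[OF assms(4,5,2) f] by blast
    have "(\<lambda>_. ()) \<in> mod_hom R N ?Z"
      by (auto simp: mod_hom_def hom_def zero_module_def)
    moreover have "f \<in> mod_hom R M N"
      using f by (simp add: u_S_epi_def)
    ultimately show ?thesis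
      using s S.one_closed assms(2,4,5) M Z
      by (intro S_finite_middle[of S R M N ?Z f "\<lambda>_. ()" s "\<one>\<^bsub>R\<^esub>"]) auto
  qed
  have two: "S_finite R S M"
    if ex: "u_S_short_exact R S L M N f g" and fin: "S_finite R S L" "S_finite R S N" for f g
  proof -
    obtain s where s: "s \<in> S" "\<And>x. \<lbrakk>x \<in> carrier M; g x = \<zero>\<^bsub>N\<^esub>\<rbrakk> \<Longrightarrow> s \<odot>\<^bsub>M\<^esub> x \<in> f ` carrier L"
      using ex by (auto simp: u_S_short_exact_def u_S_exact_def a_kernel_def')
    obtain t where t: "t \<in> S" "\<And>y. y \<in> carrier N \<Longrightarrow> t \<odot>\<^bsub>N\<^esub> y \<in> g ` carrier M"
      using ex by (auto simp: u_S_short_exact_def u_S_exact_def a_kernel_def' zero_module_def)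
    have "f \<in> mod_hom R L M" "g \<in> mod_hom R M N"
      using ex by (auto simp: u_S_short_exact_def u_S_exact_def)
    then show ?thesis
      using S_finite_middle[OF assms(2-5) _ _ s t fin] by blast
  qed
  have three: "S_finite R S M" if f: "u_S_iso R S M N f" and N: "S_finite R S N" for f
  proof -
    have epi: "u_S_epi R S M N f" and hom: "f \<in> mod_hom R M N"
      using f by (auto simp: u_S_iso_def u_S_epi_def)
    obtain t where t: "t \<in> S" "\<And>y. y \<in> carrier N \<Longrightarrow> t \<odot>\<^bsub>N\<^esub> y \<in> f ` carrier M"
      using u_S_epi_image[OF assms(4,5,2) epi] by blast
    obtain s where s: "s \<in> S" "\<And>x. \<lbrakk>x \<in> carrier M; f x = \<zero>\<^bsub>N\<^esub>\<rbrakk> \<Longrightarrow> s \<odot>\<^bsub>M\<^esub> x = \<zero>\<^bsub>M\<^esub>"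
      using f by (auto simp: u_S_iso_def u_S_mono_def u_S_torsion_def kernel_module_def a_kernel_def')
    have "(\<lambda>_. \<zero>\<^bsub>M\<^esub>) \<in> mod_hom R ?Z M"
      by (auto simp: mod_hom_def hom_def)
    moreover have "s \<odot>\<^bsub>M\<^esub> x \<in> (\<lambda>_. \<zero>\<^bsub>M\<^esub>) ` carrier ?Z" if "x \<in> carrier M" "f x = \<zero>\<^bsub>N\<^esub>" for x
      using s(2)[OF that] by (simp add: zero_module_def)
    ultimately show ?thesis
      using S_finite_middle[OF assms(2) Z(1) assms(4,5) _ hom s(1) _ t Z(2) N] by blast
  qed
  show ?thesis
    using one two three by (auto simp: u_S_iso_def)
qed

end
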